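(* The unital formal multiplication $F$ on $k^2$ given by the power series $$F\big((x_2,x_3),(y_2,y_3)\big)=\frac{1}{1+x_2y_3+x_3y_2}\,(x_2+y_2,\;x_3+y_3)$$ is not linear.
   Context: $k$ is a field of characteristic $0$. For $V=k^n$ with basis $e_1,\dots,e_n$ and coordinates $x_1,\dots,x_n$, a unital formal multiplication (a linear map $F\colon k[V]\otimes k[V]\to V$ with $F(\mu\otimes1)=\pi_V(\mu)=F(1\otimes\mu)$, where $k[V]$ is the symmetric coalgebra with elements of $V$ primitive) is identified with an $n$-tuple of formal power series $F(x,y)$ with $F(x,0)=x$, $F(0,y)=y$, by letting $F(e^{a}\otimes e^{b})$ be $\partial_x^{a}\partial_y^{b}F|_{(0,0)}$ for monomials $e^a=e_1^{a_1}\cdots e_n^{a_n}$. For a formal map $\theta\colon k[V]\to W$, $\theta'(\mu)=\sum_{n\ge0}\frac1{n!}\theta(\mu_{(1)})\cdots\theta(\mu_{(n)})$; $k[F]$ is $k[V]$ with product $F'$. A homomorphism $\psi\colon F\to H$ is a formal map with $H(\psi'(\mu_1)\otimes\psi'(\mu_2))=\psi(F'(\mu_1\otimes\mu_2))$. $F$ is linear if there exist a finite-dimensional vector space $A$ with bilinear product $*$ and a homomorphism $\psi\colon F\to G$, with $G(\mathbf x,\mathbf y)=\mathbf x+\mathbf y+\mathbf x*\mathbf y$ (i.e. $G(\mu_1\otimes\mu_2)=\epsilon(\mu_2)\pi_A(\mu_1)+\epsilon(\mu_1)\pi_A(\mu_2)+\pi_A(\mu_1)*\pi_A(\mu_2)$),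 such that $g\mapsto g\circ\psi'$, $k[A]^*\to k[V]^*$, is surjective. *)

theory Defs
  imports Main
begin

text \<open>Multi-indices: a multi-index a (exponent of the monomial e^a) is a function nat => nat.
  For V = k^n only multi-indices vanishing at coordinates >= n are used.
  A vector in k^m is a function nat => 'k (only coordinates < m are relevant).
  A linear map out of k[V] (or k[V] tensor k[V]) is given by its values on the monomial basis.\<close>

type_synonym mi = "nat \<Rightarrow> nat"

definition mi_zero :: mi where "mi_zero = (\<lambda>_. 0)"

definition mi_unit :: "nat \<Rightarrow> mi" where "mi_unit l = (\<lambda>i. if i = l then 1 else 0)"

definition mis :: "nat \<Rightarrow> mi set" where "mis n = {a. \<forall>i\<ge>n. a i = 0}"

definition mi_deg :: "mi \<Rightarrow> nat" where "mi_deg a = (\<Sum>i\<in>{i. a i \<noteq> 0}. a i)"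

definition mi_fact :: "mi \<Rightarrow> nat" where "mi_fact a = (\<Prod>i\<in>{i. a i \<noteq> 0}. fact (a i))"

definition mis_le :: "nat \<Rightarrow> nat \<Rightarrow> mi set" where
  "mis_le m d = {c. c \<in> mis m \<and> mi_deg c \<le> d}"

definition mi_sum :: "mi list \<Rightarrow> mi" where "mi_sum as = (\<lambda>i. \<Sum>c\<leftarrow>as. c i)"

text \<open>Iterated coproduct: Delta^(r)(e^a) = sum over as in decomps r a of
  (a! / prod as_i!) e^(as_1) (x) ... (x) e^(as_r)  (for r = 0 this is the counit).\<close>
definition decomps :: "nat \<Rightarrow> mi \<Rightarrow> mi list set" where
  "decomps r a = {as. length as = r \<and> (\<forall>c\<in>set as. c \<le> a) \<and> mi_sum as = a}"

text \<open>Coefficient of e^b in the product w_1 ... w_r in k[k^m] (symmetric algebra) of vectors w_i in k^m.\<close>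
definition symprod :: "nat \<Rightarrow> (nat \<Rightarrow> 'k::field) list \<Rightarrow> mi \<Rightarrow> 'k" where
  "symprod m ws b = (\<Sum>js\<in>{js. length js = length ws \<and> set js \<subseteq> {..<m} \<and> (\<forall>j. count_list js j = b j)}.
       \<Prod>i<length ws. (ws ! i) (js ! i))"

text \<open>theta'(e^a), coefficient at e^b, for a formal map theta (theta(1) = 0) with target k^m:
  theta'(mu) = sum_r 1/r! theta(mu_(1)) ... theta(mu_(r)).  Terms with r > deg a vanish since
  theta(1) = 0, so the sum is truncated there.\<close>
definition fprime :: "nat \<Rightarrow> (mi \<Rightarrow> nat \<Rightarrow> 'k::field_char_0) \<Rightarrow> mi \<Rightarrow> mi \<Rightarrow> 'k" where
  "fprime m th a b = (\<Sum>r\<le>mi_deg a. (1 / fact r) *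
      (\<Sum>as\<in>decomps r a. (of_nat (mi_fact a) / of_nat (\<Prod>c\<leftarrow>as. mi_fact c)) * symprod m (map th as) b))"

definition formal_map :: "nat \<Rightarrow> (mi \<Rightarrow> nat \<Rightarrow> 'k::zero) \<Rightarrow> bool" where
  "formal_map m th \<longleftrightarrow> (\<forall>l<m. th mi_zero l = 0)"

text \<open>A formal multiplication on k^n, Fm a b = F(e^a (x) e^b), as a formal map on
  k[V] (x) k[V] = k[V + V]: the pair (a,b) is encoded as one multi-index on 2n coordinates.\<close>
definition pair_mi :: "nat \<Rightarrow> mi \<Rightarrow> mi \<Rightarrow> mi" where
  "pair_mi n a b = (\<lambda>i. if i < n then a i else b (i - n))"

definition as_map2 :: "nat \<Rightarrow> (mi \<Rightarrow> mi \<Rightarrow> nat \<Rightarrow> 'k) \<Rightarrow> mi \<Rightarrow> nat \<Rightarrow> 'k" where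
  "as_map2 n Fm c = Fm (\<lambda>i. if i < n then c i else 0) (\<lambda>i. c (n + i))"

definition mprime :: "nat \<Rightarrow> (mi \<Rightarrow> mi \<Rightarrow> nat \<Rightarrow> 'k::field_char_0) \<Rightarrow> mi \<Rightarrow> mi \<Rightarrow> mi \<Rightarrow> 'k" where
  "mprime n Fm a b c = fprime n (as_map2 n Fm) (pair_mi n a b) c"

text \<open>psi : F -> H homomorphism, F on k^n, H on k^m:
  H(psi'(mu1) (x) psi'(mu2)) = psi(F'(mu1 (x) mu2)), checked on basis monomials, componentwise.\<close>
definition is_hom :: "nat \<Rightarrow> nat \<Rightarrow> (mi \<Rightarrow> mi \<Rightarrow> nat \<Rightarrow> 'k::field_char_0) \<Rightarrow>
    (mi \<Rightarrow> mi \<Rightarrow> nat \<Rightarrow> 'k) \<Rightarrow> (mi \<Rightarrow> nat \<Rightarrow> 'k) \<Rightarrow> bool" where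
  "is_hom n m Fm Hm psi \<longleftrightarrow> formal_map m psi \<and>
     (\<forall>a\<in>mis n. \<forall>b\<in>mis n. \<forall>l<m.
        (\<Sum>c\<in>mis_le m (mi_deg a). \<Sum>d\<in>mis_le m (mi_deg b).
            fprime m psi a c * fprime m psi b d * Hm c d l)
        = (\<Sum>c\<in>mis_le n (mi_deg a + mi_deg b). mprime n Fm a b c * psi c l))"

definition proj_mi :: "mi \<Rightarrow> nat \<Rightarrow> 'k::zero_neq_one" where
  "proj_mi c l = (if c = mi_unit l then 1 else 0)"

text \<open>G(x,y) = x + y + x*y on A = k^m, bilinear product with structure constants
  mult i j l (e_i * e_j = sum_l mult i j l e_l).\<close>
definition Gmul :: "nat \<Rightarrow> (nat \<Rightarrow> nat \<Rightarrow> nat \<Rightarrow> 'k::field) \<Rightarrow> mi \<Rightarrow> mi \<Rightarrow> nat \<Rightarrow> 'k" where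
  "Gmul m mult c d l =
     (if d = mi_zero then proj_mi c l else 0) + (if c = mi_zero then proj_mi d l else 0)
     + (\<Sum>i<m. \<Sum>j<m. proj_mi c i * proj_mi d j * mult i j l)"

definition is_linear_fm :: "nat \<Rightarrow> (mi \<Rightarrow> mi \<Rightarrow> nat \<Rightarrow> 'k::field_char_0) \<Rightarrow> bool" where
  "is_linear_fm n Fm \<longleftrightarrow> (\<exists>m (mult :: nat \<Rightarrow> nat \<Rightarrow> nat \<Rightarrow> 'k) (psi :: mi \<Rightarrow> nat \<Rightarrow> 'k).
      is_hom n m Fm (Gmul m mult) psi \<and>
      (\<forall>h :: mi \<Rightarrow> 'k. \<exists>g :: mi \<Rightarrow> 'k. \<forall>a\<in>mis n.
          (\<Sum>c\<in>mis_le m (mi_deg a). g c * fprime m psi a c) = h a))"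

text \<open>The example. Coordinates x_2, x_3 are indices 0, 1.  Coefficient of x^a y^b in
  (x_0 + y_0) / (1 + x_0 y_1 + x_1 y_0) = (x_0+y_0) sum_k (-1)^k sum_{p+q=k} C(k,p) x_0^p y_1^p x_1^q y_0^q;
  the second coordinate is obtained by swapping indices 0 and 1.\<close>
definition ex_coeff0 :: "nat \<Rightarrow> nat \<Rightarrow> nat \<Rightarrow> nat \<Rightarrow> int" where
  "ex_coeff0 a0 a1 b0 b1 =
     (if a1 = b0 \<and> a0 = b1 + 1 then (-1) ^ (b1 + b0) * int ((b1 + b0) choose b1) else 0)
   + (if b0 = a1 + 1 \<and> a0 = b1 then (-1) ^ (a0 + a1) * int ((a0 + a1) choose a0) else 0)"

text \<open>F(e^a (x) e^b) = d_x^a d_y^b F at 0 = a! b! * coefficient of x^a y^b.\<close>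
definition Fex :: "mi \<Rightarrow> mi \<Rightarrow> nat \<Rightarrow> 'k::field_char_0" where
  "Fex a b i = of_nat (mi_fact a * mi_fact b) *
     (if i = 0 then of_int (ex_coeff0 (a 0) (a 1) (b 0) (b 1))
      else if i = 1 then of_int (ex_coeff0 (a 1) (a 0) (b 1) (b 0)) else 0)"

end

theory Submission
  imports Defs "HOL-Combinatorics.Multiset_Permutations"
begin

text \<open>
  Suppose \<open>\<psi>\<close> is a homomorphism from \<open>F\<close> to \<open>x + y + x * y\<close> on \<open>k^m\<close>, and let \<open>W\<close> be the span of
  its components, a finite-dimensional space of power series in \<open>x\<close>, taken modulo constants. Since
  \<open>\<psi>(F(x,y)) = \<psi>(x) + \<psi>(y) + \<psi>(x) * \<psi>(y)\<close>, extracting the coefficient of a nontrivial monomial in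
  \<open>y\<close> from \<open>f(F(x,y))\<close> maps \<open>W\<close> to itself. Write \<open>E\<close> for the Euler field and \<open>x1, x2\<close> for the
  coordinates. The coefficients of \<open>y1\<close> and \<open>y2\<close> give \<open>D1 = d1 - x2 E\<close> and \<open>D2 = d2 - x1 E\<close>; the
  coefficient of \<open>y2^2\<close> gives an operator \<open>S2\<close> with \<open>D2^2 - 2 S2 = x1 d2\<close>. Moreover
  \<open>[D1, x1 d2] - D2 = 2 x1 E\<close>, so \<open>W\<close> is stable under \<open>x1 E\<close>. Surjectivity on duals forces some
  \<open>f\<close> in \<open>W\<close> to have a nonzero coefficient at \<open>x1\<close>, and then \<open>(x1 E)^k f\<close> restricted to \<open>x2 = 0\<close>
  has order exactly \<open>k + 1\<close> for every \<open>k\<close>, contradicting finite dimension.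
\<close>

section \<open>The extension of a formal map to coalgebras\<close>

lemma mi_deg_eq: "a \<in> mis n \<Longrightarrow> mi_deg a = (\<Sum>i<n. a i)"
  unfolding mi_deg_def mis_def by (rule sum.mono_neutral_left) (auto simp: not_less[symmetric])

lemma mi_fact_eq: "a \<in> mis n \<Longrightarrow> mi_fact a = (\<Prod>i<n. fact (a i))"
  unfolding mi_fact_def mis_def by (rule prod.mono_neutral_left) (auto simp: not_less[symmetric])

lemma mi_fact_neq_0: "mi_fact a \<noteq> 0"
  unfolding mi_fact_def by (cases "finite {i. a i \<noteq> 0}") auto

text \<open>For \<open>c\<close> in \<open>mis n\<close> the length of such a word is forced to be
  \<open>mi_deg c\<close>, so the length condition in \<open>symprod\<close> becomes a condition on
  the number of factors alone.\<close>

definition words :: "nat \<Rightarrow> mi \<Rightarrow> nat list set" where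
  "words n c = {js. set js \<subseteq> {..<n} \<and> (\<forall>j. count_list js j = c j)}"

lemma length_words:
  assumes "c \<in> mis n" and "js \<in> words n c"
  shows "length js = mi_deg c"
proof -
  have "length js = sum (count_list js) {..<n}"
    using assms(2) by (intro sum_count_set[symmetric]) (auto simp: words_def)
  also have "\<dots> = mi_deg c"
    using assms by (simp add: mi_deg_eq words_def)
  finally show ?thesis .
qed

text \<open>The coefficient of \<open>x^A\<close> in the product, over the letters \<open>j\<close> of \<open>js\<close>, of the series
  \<open>sum_B th(e^B)_j x^B / B!\<close>.\<close>
definition word_coeff :: "(mi \<Rightarrow> nat \<Rightarrow> 'k::field_char_0) \<Rightarrow> nat list \<Rightarrow> mi \<Rightarrow> 'k" where
  "word_coeff th js A = (\<Sum>as\<in>decomps (length js) A.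
     \<Prod>i<length js. th (as ! i) (js ! i) / of_nat (mi_fact (as ! i)))"

lemma symprod_eq:
  assumes "c \<in> mis n"
  shows "symprod n ws c = (if length ws = mi_deg c
    then \<Sum>js\<in>words n c. \<Prod>i<length ws. (ws ! i) (js ! i) else 0)"
proof -
  have *: "{js. length js = length ws \<and> set js \<subseteq> {..<n} \<and> (\<forall>j. count_list js j = c j)}
      = (if length ws = mi_deg c then words n c else {})"
    using length_words[OF assms] unfolding words_def by force
  show ?thesis unfolding symprod_def * by simp
qed

text \<open>A product of \<open>r\<close> vectors is homogeneous of degree \<open>r\<close>, so only
  \<open>r = mi_deg c\<close> survives. The multinomial factor of the coproduct splits into one
  \<open>1/B!\<close> per factor, which turns the derivatives \<open>th B\<close> into power series
  coefficients.\<close>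

lemma fprime_eq:
  fixes th :: "mi \<Rightarrow> nat \<Rightarrow> 'k::field_char_0"
  assumes c: "c \<in> mis n"
  shows "fprime n th A c = (if mi_deg c \<le> mi_deg A
    then of_nat (mi_fact A) / fact (mi_deg c) * (\<Sum>js\<in>words n c. word_coeff th js A) else 0)"
proof -
  let ?r = "mi_deg c"
  let ?S = "\<lambda>r. \<Sum>as\<in>decomps r A. (of_nat (mi_fact A) / of_nat (\<Prod>c\<leftarrow>as. mi_fact c)) * symprod n (map th as) c"
  have S0: "?S r = 0" if "r \<noteq> ?r" for r
    by (rule sum.neutral) (use that in \<open>auto simp: symprod_eq[OF c] decomps_def\<close>)
  have "?S ?r = (\<Sum>as\<in>decomps ?r A. \<Sum>js\<in>words n c. of_nat (mi_fact A) *
        (\<Prod>i<length js. th (as ! i) (js ! i) / of_nat (mi_fact (as ! i))))"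
  proof (rule sum.cong[OF refl])
    fix as assume "as \<in> decomps ?r A"
    then have len: "length as = ?r" by (simp add: decomps_def)
    have P: "of_nat (\<Prod>c\<leftarrow>as. mi_fact c) = (\<Prod>i<?r. of_nat (mi_fact (as ! i)) :: 'k)"
      by (simp add: prod.list_conv_set_nth len atLeast0LessThan)
    have "of_nat (mi_fact A) / of_nat (\<Prod>c\<leftarrow>as. mi_fact c) * symprod n (map th as) c
      = (\<Sum>js\<in>words n c. of_nat (mi_fact A) * ((\<Prod>i<?r. th (as ! i) (js ! i)) / (\<Prod>i<?r. of_nat (mi_fact (as ! i)) :: 'k)))"
      unfolding P symprod_eq[OF c] using len by (simp add: sum_distrib_left)
    also have "\<dots> = (\<Sum>js\<in>words n c. of_nat (mi_fact A) *
        (\<Prod>i<length js. th (as ! i) (js ! i) / of_nat (mi_fact (as ! i))))"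
      by (intro sum.cong refl) (simp add: prod_dividef length_words[OF c])
    finally show "of_nat (mi_fact A) / of_nat (\<Prod>c\<leftarrow>as. mi_fact c) * symprod n (map th as) c = \<dots>" .
  qed
  also have "\<dots> = of_nat (mi_fact A) * (\<Sum>js\<in>words n c. word_coeff th js A)"
    by (subst sum.swap) (simp add: sum_distrib_left word_coeff_def length_words[OF c])
  finally have S1: "?S ?r = of_nat (mi_fact A) * (\<Sum>js\<in>words n c. word_coeff th js A)" .
  have "fprime n th A c = (\<Sum>r\<le>mi_deg A. if r = ?r then (1 / fact ?r) * ?S ?r else 0)"
    unfolding fprime_def
  proof (intro sum.cong refl)
    fix r
    show "1 / fact r * ?S r = (if r = ?r then 1 / fact ?r * ?S ?r else 0)"
      using S0[of r] by (cases "r = ?r") auto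
  qed
  then show ?thesis unfolding S1 by simp
qed

lemma word_coeff_Nil: "word_coeff th [] A = (if A = mi_zero then 1 else 0)"
proof -
  have "decomps 0 A = (if A = mi_zero then {[]} else {})"
    by (auto simp: decomps_def mi_sum_def mi_zero_def)
  then show ?thesis by (simp add: word_coeff_def)
qed

text \<open>Each remaining part is at most the sum of the remaining parts, which is
  \<open>A - B\<close>; this supplies the bound that \<open>decomps\<close> demands.\<close>

lemma decomps_Suc:
  "decomps (Suc r) A = (\<lambda>(B, as). B # as) ` (SIGMA B:{B. B \<le> A}. decomps r (\<lambda>i. A i - B i))"
proof (intro equalityI subsetI)
  fix xs assume xs: "xs \<in> decomps (Suc r) A"
  then obtain B as where [simp]: "xs = B # as"
    by (cases xs) (auto simp: decomps_def)
  from xs have A: "A i = B i + (\<Sum>c\<leftarrow>as. c i)" for i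
    by (auto simp: decomps_def mi_sum_def)
  have le: "c i \<le> (\<Sum>c\<leftarrow>as. c i)" if "c \<in> set as" for c i
    using that by (induction as) (auto intro: trans_le_add2)
  show "xs \<in> (\<lambda>(B, as). B # as) ` (SIGMA B:{B. B \<le> A}. decomps r (\<lambda>i. A i - B i))"
    using xs A le by (auto simp: decomps_def mi_sum_def le_fun_def image_iff)
next
  fix xs assume "xs \<in> (\<lambda>(B, as). B # as) ` (SIGMA B:{B. B \<le> A}. decomps r (\<lambda>i. A i - B i))"
  then show "xs \<in> decomps (Suc r) A"
    by (auto simp: decomps_def mi_sum_def le_fun_def fun_eq_iff) (meson diff_le_self le_trans)
qed

lemma finite_mi_le:
  assumes "A \<in> mis n" shows "finite {B. B \<le> A}"
proof (rule finite_subset)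
  show "{B. B \<le> A} \<subseteq> {B. \<forall>i. (i \<in> {..<n} \<longrightarrow> B i \<in> {..\<Sum>i<n. A i}) \<and> (i \<notin> {..<n} \<longrightarrow> B i = 0)}"
  proof (intro subsetI CollectI allI)
    fix B i assume "B \<in> {B. B \<le> A}"
    then have B: "B i \<le> A i" by (simp add: le_fun_def)
    have "A i \<le> (\<Sum>i<n. A i)" if "i < n" using that by (intro member_le_sum) auto
    with B assms show "(i \<in> {..<n} \<longrightarrow> B i \<in> {..\<Sum>i<n. A i}) \<and> (i \<notin> {..<n} \<longrightarrow> B i = 0)"
      by (force simp: mis_def)
  qed
  show "finite {B :: mi. \<forall>i. (i \<in> {..<n} \<longrightarrow> B i \<in> {..\<Sum>i<n. A i}) \<and> (i \<notin> {..<n} \<longrightarrow> B i = 0)}"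
    by (rule finite_set_of_finite_funs) auto
qed

lemma finite_decomps: "A \<in> mis n \<Longrightarrow> finite (decomps r A)"
proof (induction r arbitrary: A)
  case 0
  show ?case by (rule finite_subset[of _ "{[]}"]) (auto simp: decomps_def)
next
  case (Suc r)
  then show ?case
    unfolding decomps_Suc
    by (intro finite_imageI finite_SigmaI finite_mi_le[of _ n] Suc.IH) (auto simp: mis_def)
qed

text \<open>The Cauchy product: the first series contributes its coefficient at \<open>B\<close>,
  the rest of the word that at \<open>A - B\<close>.\<close>

lemma word_coeff_Cons:
  assumes "A \<in> mis n"
  shows "word_coeff th (j # js) A =
    (\<Sum>B\<in>{B. B \<le> A}. th B j / of_nat (mi_fact B) * word_coeff th js (\<lambda>i. A i - B i))"
proof -
  have fin: "\<forall>B\<in>{B. B \<le> A}. finite (decomps (length js) (\<lambda>i. A i - B i))"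
    using assms by (intro ballI finite_decomps[of _ n]) (auto simp: mis_def)
  have "word_coeff th (j # js) A =
    (\<Sum>(B, as)\<in>(SIGMA B:{B. B \<le> A}. decomps (length js) (\<lambda>i. A i - B i)).
       th B j / of_nat (mi_fact B) * (\<Prod>i<length js. th (as ! i) (js ! i) / of_nat (mi_fact (as ! i))))"
    unfolding word_coeff_def length_Cons decomps_Suc
    by (subst sum.reindex)
       (auto simp: inj_on_def prod.lessThan_Suc_shift simp del: prod.lessThan_Suc intro!: sum.cong)
  also have "\<dots> = (\<Sum>B\<in>{B. B \<le> A}. th B j / of_nat (mi_fact B) * word_coeff th js (\<lambda>i. A i - B i))"
    unfolding word_coeff_def sum_distrib_left
    by (rule sum.Sigma[symmetric]) (use fin finite_mi_le[OF assms] in auto)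
  finally show ?thesis .
qed

section \<open>Homomorphisms into a bilinear multiplication\<close>

text \<open>The constant part of th' is the counit. Its vanishing on nontrivial monomials later
  removes the linear terms of \<open>Gmul\<close>.\<close>

lemma fprime_mi_zero: "fprime m th a mi_zero = (if a = mi_zero then 1 else 0)"
proof -
  have "words m mi_zero = {[]}"
    by (auto simp: words_def mi_zero_def count_list_0_iff)
  moreover have "mi_zero \<in> mis m" "mi_deg mi_zero = 0" "mi_fact mi_zero = 1"
    by (auto simp: mis_def mi_zero_def mi_deg_def mi_fact_def)
  ultimately show ?thesis by (simp add: fprime_eq word_coeff_Nil)
qed

lemma words_mi_unit:
  assumes "l < m" shows "words m (mi_unit l) = {[l]}"
proof -
  have "js = [l]" if "js \<in> words m (mi_unit l)" for js
  proof -
    have len: "length js = 1"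
      using length_words[OF _ that] assms by (simp add: mis_def mi_unit_def mi_deg_def)
    then obtain x where "js = [x]" by (auto simp: length_Suc_conv)
    with that show ?thesis by (auto simp: words_def mi_unit_def split: if_splits)
  qed
  then show ?thesis using assms by (auto simp: words_def mi_unit_def)
qed

lemma word_coeff_single: "word_coeff th [l] A = th A l / of_nat (mi_fact A)"
proof -
  have "decomps 1 A = {[A]}"
    by (auto simp: decomps_def mi_sum_def length_Suc_conv)
  then show ?thesis by (simp add: word_coeff_def)
qed

text \<open>The degree one part of th' is \<open>th\<close> itself. For \<open>a\<close> of degree 0
  the truncated sum gives 0, in agreement with \<open>th\<close> because a formal map vanishes at
  1.\<close>

lemma fprime_mi_unit:
  assumes "formal_map m th" and "l < m" and "a \<in> mis n"
  shows "fprime m th a (mi_unit l) = th a l"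
proof -
  have u: "mi_unit l \<in> mis m" "mi_deg (mi_unit l) = 1"
    using assms(2) by (auto simp: mis_def mi_unit_def mi_deg_def)
  have "a = mi_zero" if "mi_deg a = 0"
    using that assms(3) by (auto simp: mi_deg_eq mis_def mi_zero_def fun_eq_iff not_less[symmetric])
  then have "th a l = 0" if "mi_deg a = 0"
    using that assms(1,2) by (auto simp: formal_map_def)
  then show ?thesis
    by (simp add: fprime_eq u words_mi_unit[OF assms(2)] word_coeff_single mi_fact_neq_0 not_less_eq_eq)
qed

lemma finite_mis_le: "finite (mis_le m d)"
proof -
  have "mis_le m d \<subseteq> {c. c \<le> (\<lambda>i. if i < m then d else 0)}"
  proof
    fix c assume "c \<in> mis_le m d"
    then have c: "c \<in> mis m" "(\<Sum>i<m. c i) \<le> d" by (auto simp: mis_le_def mi_deg_eq)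
    have "c i \<le> (\<Sum>i<m. c i)" if "i < m" for i using that by (intro member_le_sum) auto
    with c show "c \<in> {c. c \<le> (\<lambda>i. if i < m then d else 0)}"
      by (force simp: le_fun_def mis_def)
  qed
  then show ?thesis
    by (rule finite_subset) (rule finite_mi_le[of _ m], simp add: mis_def)
qed

lemma mi_unit_in_mis_le:
  assumes "l < m" "a \<in> mis n" "a \<noteq> mi_zero" shows "mi_unit l \<in> mis_le m (mi_deg a)"
proof -
  have "mi_deg a \<noteq> 0"
    using assms(2,3) by (auto simp: mi_deg_eq mis_def mi_zero_def fun_eq_iff not_less[symmetric])
  then show ?thesis using assms(1) by (auto simp: mis_le_def mis_def mi_unit_def mi_deg_def)
qed

lemma sum_fprime_proj_mi:
  assumes "formal_map m psi" "a \<in> mis n" "a \<noteq> mi_zero" "l < m"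
  shows "(\<Sum>c\<in>mis_le m (mi_deg a). fprime m psi a c * proj_mi c l) = psi a l"
proof -
  have "(\<Sum>c\<in>mis_le m (mi_deg a). fprime m psi a c * proj_mi c l)
      = (\<Sum>c\<in>mis_le m (mi_deg a). if c = mi_unit l then fprime m psi a c else 0)"
    by (intro sum.cong) (auto simp: proj_mi_def)
  then show ?thesis
    using assms by (simp add: finite_mis_le mi_unit_in_mis_le fprime_mi_unit)
qed

text \<open>Neither psi'(e^a) nor psi'(e^b) has a constant term, so only \<open>x * y\<close>
  survives from \<open>x + y + x * y\<close>. What remains is a combination of the
  \<open>psi a i\<close> with coefficients depending only on \<open>b\<close> and
  \<open>l\<close>.\<close>

lemma hom_Gmul_eq:
  assumes "is_hom n m Fm (Gmul m mul) psi" and "l < m"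
    and a: "a \<in> mis n" "a \<noteq> mi_zero" and b: "b \<in> mis n" "b \<noteq> mi_zero"
  shows "(\<Sum>c\<in>mis_le n (mi_deg a + mi_deg b). mprime n Fm a b c * psi c l)
    = (\<Sum>i<m. psi a i * (\<Sum>j<m. psi b j * mul i j l))"
proof -
  have fm: "formal_map m psi" using assms(1) by (simp add: is_hom_def)
  let ?P = "fprime m psi" and ?A = "mis_le m (mi_deg a)" and ?B = "mis_le m (mi_deg b)"
  have Z: "?P a c * ?P b d * Gmul m mul c d l =
    (\<Sum>i<m. \<Sum>j<m. (?P a c * proj_mi c i) * ((?P b d * proj_mi d j) * mul i j l))" for c d
  proof (cases "c = mi_zero \<or> d = mi_zero")
    case True
    then have "?P a c * ?P b d = 0" using a b by (auto simp: fprime_mi_zero)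
    then show ?thesis by (auto intro!: sum.neutral[symmetric])
  next
    case False
    then show ?thesis by (simp add: Gmul_def sum_distrib_left mult_ac)
  qed
  have "(\<Sum>c\<in>mis_le n (mi_deg a + mi_deg b). mprime n Fm a b c * psi c l)
    = (\<Sum>c\<in>?A. \<Sum>d\<in>?B. ?P a c * ?P b d * Gmul m mul c d l)"
    using assms(1)[unfolded is_hom_def, THEN conjunct2, rule_format, OF a(1) b(1) assms(2)] by (rule sym)
  also have "\<dots> = (\<Sum>c\<in>?A. \<Sum>i<m. \<Sum>d\<in>?B. \<Sum>j<m. (?P a c * proj_mi c i) * ((?P b d * proj_mi d j) * mul i j l))"
    unfolding Z by (intro sum.cong refl sum.swap)
  also have "\<dots> = (\<Sum>i<m. \<Sum>c\<in>?A. (?P a c * proj_mi c i) * (\<Sum>j<m. (\<Sum>d\<in>?B. ?P b d * proj_mi d j) * mul i j l))"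
    unfolding sum_distrib_right sum_distrib_left
    by (subst sum.swap) (intro sum.cong refl sum.swap)
  also have "\<dots> = (\<Sum>i<m. (\<Sum>c\<in>?A. ?P a c * proj_mi c i) * (\<Sum>j<m. (\<Sum>d\<in>?B. ?P b d * proj_mi d j) * mul i j l))"
    by (simp add: sum_distrib_right)
  also have "\<dots> = (\<Sum>i<m. psi a i * (\<Sum>j<m. psi b j * mul i j l))"
    using fm a b by (intro sum.cong refl) (simp add: sum_fprime_proj_mi)
  finally show ?thesis .
qed

text \<open>In degree one psi'(e^a) is psi(e^a). If that were 0, every functional pulled back along
  psi' would vanish at e^a, against surjectivity for \<open>h = 1\<close>.\<close>

lemma surj_imp_psi_neq_0:
  assumes "is_hom n m Fm H psi" and a: "a \<in> mis n" "mi_deg a = 1"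
    and "\<forall>h :: mi \<Rightarrow> 'k::field_char_0. \<exists>g :: mi \<Rightarrow> 'k. \<forall>a\<in>mis n.
          (\<Sum>c\<in>mis_le m (mi_deg a). g c * fprime m psi a c) = h a"
  shows "\<exists>l<m. psi a l \<noteq> 0"
proof (rule ccontr)
  assume "\<not> ?thesis"
  then have 0: "psi a l = 0" if "l < m" for l using that by auto
  have fm: "formal_map m psi" using assms(1) by (simp add: is_hom_def)
  have a0: "a \<noteq> mi_zero" using a by (auto simp: mi_deg_def mi_zero_def)
  \<comment> \<open>A multi-index of degree at most 1 is \<open>mi_zero\<close> or some
    \<open>mi_unit l\<close>; the coefficient is 0 in the first case since \<open>a\<close> is
    nontrivial, and is \<open>psi a l\<close> in the second.\<close>
  have fp: "fprime m psi a c = 0" if "c \<in> mis_le m (mi_deg a)" for c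
  proof (cases "c = mi_zero")
    case True then show ?thesis using a0 by (simp add: fprime_mi_zero)
  next
    case False
    have c: "c \<in> mis m" "(\<Sum>i<m. c i) \<le> 1" using that a by (auto simp: mis_le_def mi_deg_eq)
    obtain l where l: "c l \<noteq> 0" using False by (auto simp: mi_zero_def fun_eq_iff)
    then have lm: "l < m" using c by (auto simp: mis_def not_less[symmetric])
    have S: "(\<Sum>i<m. c i) = c l + (\<Sum>i\<in>{..<m} - {l}. c i)" using lm by (simp add: sum.remove)
    have "c i = mi_unit l i" for i
    proof (cases "i < m \<and> i \<noteq> l")
      case True
      then have "c i \<le> (\<Sum>i\<in>{..<m} - {l}. c i)" by (intro member_le_sum) auto
      then have "c i = 0" using S c(2) l by linarith
      with True show ?thesis by (simp add: mi_unit_def)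
    next
      case False
      have cl: "c l = 1" using S c(2) l by linarith
      show ?thesis
      proof (cases "i = l")
        case True
        with cl show ?thesis by (simp add: mi_unit_def)
      next
        case False
        with \<open>\<not> (i < m \<and> i \<noteq> l)\<close> have "m \<le> i" by simp
        with c(1) have "c i = 0" unfolding mis_def by blast
        with False show ?thesis by (simp add: mi_unit_def)
      qed
    qed
    then have "c = mi_unit l" ..
    then show ?thesis using fprime_mi_unit[OF fm lm a(1)] 0[OF lm] by simp
  qed
  from assms(4)[rule_format, of "\<lambda>_. 1"] obtain g :: "mi \<Rightarrow> 'k"
    where "\<forall>a\<in>mis n. (\<Sum>c\<in>mis_le m (mi_deg a). g c * fprime m psi a c) = 1" by blast
  with a have "(\<Sum>c\<in>mis_le m (mi_deg a). g c * fprime m psi a c) = 1" by blast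
  with fp show False by simp
qed

text \<open>Gaussian elimination, one coordinate at a time. The family is indexed by
  \<open>K\<close>, so repeated vectors count separately.\<close>

lemma linear_dependence:
  fixes v :: "'a \<Rightarrow> nat \<Rightarrow> 'k::field"
  assumes "finite K" and "m < card K"
  shows "\<exists>c. (\<exists>k\<in>K. c k \<noteq> 0) \<and> (\<forall>i<m. (\<Sum>k\<in>K. c k * v k i) = 0)"
  using assms
proof (induction m arbitrary: K v)
  case 0
  then have "K \<noteq> {}" by auto
  then show ?case by (intro exI[of _ "\<lambda>_. 1"]) auto
next
  case (Suc m)
  show ?case
  proof (cases "\<forall>k\<in>K. v k m = 0")
    case True
    obtain c where "\<exists>k\<in>K. c k \<noteq> 0" "\<forall>i<m. (\<Sum>k\<in>K. c k * v k i) = 0"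
      using Suc.IH[of K v] Suc.prems by auto
    with True show ?thesis by (intro exI[of _ c]) (auto simp: less_Suc_eq)
  next
    case False
    then obtain k0 where k0: "k0 \<in> K" "v k0 m \<noteq> 0" by auto
    let ?K = "K - {k0}"
    \<comment> \<open>Subtracting a multiple of the pivot vector \<open>v k0\<close> clears
      coordinate \<open>m\<close>.\<close>
    define w where "w k i = v k i - v k m / v k0 m * v k0 i" for k i
    obtain c where c: "\<exists>k\<in>?K. c k \<noteq> 0" "\<forall>i<m. (\<Sum>k\<in>?K. c k * w k i) = 0"
      using Suc.IH[of ?K w] Suc.prems k0(1) by (auto simp: less_diff_conv)
    have cm: "\<forall>i<Suc m. (\<Sum>k\<in>?K. c k * w k i) = 0"
      using c(2) k0(2) by (auto simp: less_Suc_eq w_def)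
    \<comment> \<open>The coefficient at the pivot makes the \<open>d\<close>-combination of the
      \<open>v k\<close> equal to the \<open>c\<close>-combination of the
      \<open>w k\<close>.\<close>
    define d where "d = c(k0 := - (\<Sum>k\<in>?K. c k * (v k m / v k0 m)))"
    have "(\<Sum>k\<in>K. d k * v k i) = 0" if "i < Suc m" for i
    proof -
      have "(\<Sum>k\<in>K. d k * v k i) = d k0 * v k0 i + (\<Sum>k\<in>?K. d k * v k i)"
        using k0(1) Suc.prems(1) by (simp add: sum.remove)
      also have "(\<Sum>k\<in>?K. d k * v k i) = (\<Sum>k\<in>?K. c k * v k i)"
        by (intro sum.cong) (auto simp: d_def)
      also have "d k0 * v k0 i + \<dots> = (\<Sum>k\<in>?K. c k * w k i)"
        by (simp add: d_def w_def sum_distrib_right sum_subtractf right_diff_distrib mult.assoc)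
      also have "\<dots> = 0" using cm that by blast
      finally show ?thesis .
    qed
    moreover have "\<exists>k\<in>K. d k \<noteq> 0" using c(1) by (auto simp: d_def)
    ultimately show ?thesis by blast
  qed
qed

section \<open>The example in coordinates\<close>

definition mi2 :: "nat \<Rightarrow> nat \<Rightarrow> mi" where
  "mi2 p q = (\<lambda>i. if i = 0 then p else if i = 1 then q else 0)"

lemma mi2_apply: "mi2 p q 0 = p" "mi2 p q (Suc 0) = q"
  by (simp_all add: mi2_def)

lemma mi2_in_mis: "mi2 p q \<in> mis 2"
  by (auto simp: mi2_def mis_def)

lemma mi2_eq: "c \<in> mis 2 \<Longrightarrow> c = mi2 (c 0) (c (Suc 0))"
  by (auto simp: mi2_def mis_def fun_eq_iff)

lemma mi_deg_mis2: "c \<in> mis 2 \<Longrightarrow> mi_deg c = c 0 + c (Suc 0)"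
  by (simp add: mi_deg_eq numeral_2_eq_2)

lemma mi_deg_mi2: "mi_deg (mi2 p q) = p + q"
  by (subst mi_deg_eq[OF mi2_in_mis]) (simp add: numeral_2_eq_2 mi2_def)

lemma mi_fact_mi2: "mi_fact (mi2 p q) = fact p * fact q"
  by (subst mi_fact_eq[OF mi2_in_mis]) (simp add: numeral_2_eq_2 mi2_def)

lemma pair_mi2_in_mis: "pair_mi 2 (mi2 p q) (mi2 r s) \<in> mis 4"
  by (auto simp: mis_def pair_mi_def mi2_def)

lemma sum_mis_le_2: "(\<Sum>c\<in>mis_le 2 d. g (c 0) (c 1)) = (\<Sum>(u, v)\<in>{(u, v). u + v \<le> d}. g u v)"
  by (rule sum.reindex_bij_witness[of _ "\<lambda>(u, v). mi2 u v" "\<lambda>c. (c 0, c 1)"])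
     (auto simp: mis_le_def mi_deg_mi2 mi2_in_mis mi2_eq[symmetric] mi2_apply mi_deg_mis2)

text \<open>These words are the arrangements of a multiset on two letters, counted by a binomial
  coefficient; the product form avoids division in \<open>nat\<close>.\<close>

lemma card_words_2:
  "card (words 2 c) * (fact (c 0) * fact (c 1)) = (fact (c 0 + c 1) :: nat)" if "c \<in> mis 2"
proof -
  let ?M = "replicate_mset (c 0) 0 + replicate_mset (c 1) (1::nat)"
  have "js \<in> words 2 c \<longleftrightarrow> mset js = ?M" for js
  proof
    assume "js \<in> words 2 c"
    then show "mset js = ?M"
      using that by (auto simp: words_def multiset_eq_iff count_mset mis_def)
  next
    assume M: "mset js = ?M"
    then have "count_list js j = count ?M j" for j by (metis count_mset)
    moreover have "set js \<subseteq> {..<2}" using M[THEN arg_cong[of _ _ set_mset]] by (auto split: if_splits)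
    ultimately show "js \<in> words 2 c" using that by (auto simp: words_def mis_def)
  qed
  then have "words 2 c = permutations_of_multiset ?M"
    by (auto simp: permutations_of_multiset_def)
  \<comment> \<open>A letter of multiplicity 0 is absent from \<open>set_mset ?M\<close>; its factor
    is \<open>fact 0 = 1\<close>.\<close>
  moreover have "(\<Prod>x\<in>set_mset ?M. fact (count ?M x)) = (\<Prod>x\<in>{0,1}. fact (count ?M x) :: nat)"
    by (rule prod.mono_neutral_left) (auto split: if_splits)
  ultimately show ?thesis
    using card_permutations_of_multiset_aux[of ?M] by simp
qed

section \<open>Coefficients of low order in \<open>y\<close> of products of the components of
  \<open>F\<close>\<close>

definition ex_coeff :: "nat \<Rightarrow> nat \<Rightarrow> nat \<Rightarrow> nat \<Rightarrow> nat \<Rightarrow> 'k::field_char_0" where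
  "ex_coeff j p q r s = of_int (if j = 0 then ex_coeff0 p q r s else ex_coeff0 q p s r)"

abbreviation ex_word_coeff :: "nat list \<Rightarrow> nat \<Rightarrow> nat \<Rightarrow> nat \<Rightarrow> nat \<Rightarrow> 'k::field_char_0" where
  "ex_word_coeff js p q r s \<equiv> word_coeff (as_map2 2 Fex) js (pair_mi 2 (mi2 p q) (mi2 r s))"

lemma mi_fact_pair_mi2: "mi_fact (pair_mi 2 (mi2 p q) (mi2 r s)) = fact p * fact q * fact r * fact s"
  by (subst mi_fact_eq[OF pair_mi2_in_mis]) (simp add: pair_mi_def mi2_def numeral_eq_Suc)

lemma mi_deg_pair_mi2: "mi_deg (pair_mi 2 (mi2 p q) (mi2 r s)) = p + q + r + s"
  by (subst mi_deg_eq[OF pair_mi2_in_mis]) (simp add: pair_mi_def mi2_def numeral_eq_Suc)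

text \<open>The division undoes the factorials in \<open>Fex\<close>, leaving the ordinary
  coefficient of \<open>x1^p x2^q y1^r y2^s\<close> in a component of \<open>F\<close>.\<close>

lemma as_map2_Fex:
  assumes "j < 2"
  shows "as_map2 2 Fex (pair_mi 2 (mi2 p q) (mi2 r s)) j
    / of_nat (mi_fact (pair_mi 2 (mi2 p q) (mi2 r s))) = (ex_coeff j p q r s :: 'k::field_char_0)"
proof -
  have "(\<lambda>i. if i < 2 then pair_mi 2 (mi2 p q) (mi2 r s) i else 0) = mi2 p q"
       "(\<lambda>i. pair_mi 2 (mi2 p q) (mi2 r s) (2 + i)) = mi2 r s"
    by (auto simp: pair_mi_def mi2_def fun_eq_iff)
  then have "as_map2 2 Fex (pair_mi 2 (mi2 p q) (mi2 r s)) = (Fex (mi2 p q) (mi2 r s) :: nat \<Rightarrow> 'k)"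
    by (simp add: as_map2_def)
  then show ?thesis using assms
    by (auto simp: Fex_def mi_fact_pair_mi2 mi_fact_mi2 ex_coeff_def) (simp_all add: mi2_def)
qed

lemma ex_word_coeff_Nil:
  "ex_word_coeff [] p q r s = (if p = 0 \<and> q = 0 \<and> r = 0 \<and> s = 0 then 1 else 0)"
proof -
  have "pair_mi 2 (mi2 p q) (mi2 r s) = mi_zero \<longleftrightarrow> mi_deg (pair_mi 2 (mi2 p q) (mi2 r s)) = 0"
    using pair_mi2_in_mis[of p q r s]
    by (auto simp: mi_deg_eq[OF pair_mi2_in_mis] mis_def mi_zero_def fun_eq_iff not_less[symmetric])
  then show ?thesis by (auto simp: word_coeff_Nil mi_deg_pair_mi2)
qed

text \<open>The \<open>y\<close>-exponents are summed outermost: once \<open>r\<close> and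
  \<open>s\<close> are numerals these sums expand, and the inner sums over
  \<open>x\<close>-exponents collapse by \<open>sum_delta2\<close>.\<close>

lemma ex_word_coeff_Cons:
  assumes "j < 2"
  shows "ex_word_coeff (j # js) p q r s = (\<Sum>r'\<le>r. \<Sum>s'\<le>s. \<Sum>p'\<le>p. \<Sum>q'\<le>q.
    ex_coeff j p' q' r' s' * ex_word_coeff js (p - p') (q - q') (r - r') (s - s'))"
proof -
  let ?A = "pair_mi 2 (mi2 p q) (mi2 r s)"
  let ?g = "\<lambda>B. as_map2 2 Fex B j / of_nat (mi_fact B) * word_coeff (as_map2 2 Fex) js (\<lambda>i. ?A i - B i)"
  have sub: "(\<lambda>i. ?A i - pair_mi 2 (mi2 p' q') (mi2 r' s') i) =
      pair_mi 2 (mi2 (p - p') (q - q')) (mi2 (r - r') (s - s'))" for p' q' r' s'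
    by (auto simp: pair_mi_def mi2_def fun_eq_iff)
  have B: "B = pair_mi 2 (mi2 (B 0) (B 1)) (mi2 (B 2) (B 3))" if "B \<le> ?A" for B
  proof
    fix i
    have "B i \<le> ?A i" using that by (simp add: le_fun_def)
    moreover have "i = 0 \<or> i = 1 \<or> i = 2 \<or> i = 3 \<or> 4 \<le> i" by linarith
    ultimately show "B i = pair_mi 2 (mi2 (B 0) (B 1)) (mi2 (B 2) (B 3)) i"
      by (auto simp: pair_mi_def mi2_def)
  qed
  have le': "pair_mi 2 (mi2 p' q') (mi2 r' s') \<le> ?A" if "p' \<le> p" "q' \<le> q" "r' \<le> r" "s' \<le> s" for p' q' r' s'
    using that by (auto simp: le_fun_def pair_mi_def mi2_def)
  have nth: "pair_mi 2 (mi2 p' q') (mi2 r' s') 0 = p'" "pair_mi 2 (mi2 p' q') (mi2 r' s') (Suc 0) = q'"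
      "pair_mi 2 (mi2 p' q') (mi2 r' s') 2 = r'" "pair_mi 2 (mi2 p' q') (mi2 r' s') 3 = s'" for p' q' r' s'
    by (simp_all add: pair_mi_def mi2_def)
  have le: "B 0 \<le> p" "B 1 \<le> q" "B 2 \<le> r" "B 3 \<le> s" if "B \<le> ?A" for B
    using that[unfolded le_fun_def, rule_format, of 0] that[unfolded le_fun_def, rule_format, of 1]
      that[unfolded le_fun_def, rule_format, of 2] that[unfolded le_fun_def, rule_format, of 3]
    by (auto simp: pair_mi_def mi2_def)
  have "ex_word_coeff (j # js) p q r s = (\<Sum>B\<in>{B. B \<le> ?A}. ?g B)"
    by (rule word_coeff_Cons[OF pair_mi2_in_mis])
  also have "\<dots> = (\<Sum>(r', s', p', q')\<in>{..r} \<times> {..s} \<times> {..p} \<times> {..q}.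
      ?g (pair_mi 2 (mi2 p' q') (mi2 r' s')))"
    by (rule sum.reindex_bij_witness[of _ "\<lambda>(r', s', p', q'). pair_mi 2 (mi2 p' q') (mi2 r' s')"
          "\<lambda>B. (B 2, B 3, B 0, B 1)"])
       (auto simp: B[symmetric, simplified] nth le' dest: le)
  also have "\<dots> = (\<Sum>r'\<le>r. \<Sum>s'\<le>s. \<Sum>p'\<le>p. \<Sum>q'\<le>q. ?g (pair_mi 2 (mi2 p' q') (mi2 r' s')))"
    by (simp add: sum.cartesian_product)
  also have "\<dots> = (\<Sum>r'\<le>r. \<Sum>s'\<le>s. \<Sum>p'\<le>p. \<Sum>q'\<le>q.
    ex_coeff j p' q' r' s' * ex_word_coeff js (p - p') (q - q') (r - r') (s - s'))"
    by (simp only: as_map2_Fex[OF assms] sub)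
  finally show ?thesis .
qed

lemma sum_delta2:
  fixes g :: "nat \<Rightarrow> nat \<Rightarrow> 'k::field"
  shows "(\<Sum>p'\<le>p. \<Sum>q'\<le>q. (if p' = u \<and> q' = v then w else 0) * g p' q')
    = (if u \<le> p \<and> v \<le> q then w * g u v else 0)"
proof -
  have "(\<Sum>p'\<le>p. \<Sum>q'\<le>q. (if p' = u \<and> q' = v then w else 0) * g p' q')
      = (\<Sum>p'\<le>p. \<Sum>q'\<le>q. if q' = v then (if p' = u then w * g u v else 0) else 0)"
    by (intro sum.cong refl) auto
  then show ?thesis by (cases "v \<le> q") simp_all
qed

text \<open>This and the next three lemmas record the terms in 1, \<open>y1\<close>,
  \<open>y2\<close> and \<open>y2^2\<close>:
  \<open>F1 = x1 + (1 - x1 x2) y1 - x1^2 y2 + x1^3 y2^2 + ...\<close> and \<open>F2 = x2 - x2^2 y1 +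
  (1 - x1 x2) y2 + (x1^2 x2 - x1) y2^2 + ...\<close>.\<close>

lemma ex_coeff_00:
  "ex_coeff 0 p q 0 0 = (if p = 1 \<and> q = 0 then 1 else 0)"
  "ex_coeff (Suc 0) p q 0 0 = (if p = 0 \<and> q = 1 then 1 else 0)"
  by (auto simp: ex_coeff_def ex_coeff0_def)

lemma ex_coeff_10:
  "ex_coeff 0 p q (Suc 0) 0 = (if p = 0 \<and> q = 0 then 1 else 0) + (if p = 1 \<and> q = 1 then -1 else 0)"
  "ex_coeff (Suc 0) p q (Suc 0) 0 = (if p = 0 \<and> q = 2 then -1 else 0)"
  by (auto simp: ex_coeff_def ex_coeff0_def)

lemma ex_coeff_01:
  "ex_coeff 0 p q 0 (Suc 0) = (if p = 2 \<and> q = 0 then -1 else 0)"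
  "ex_coeff (Suc 0) p q 0 (Suc 0) = (if p = 0 \<and> q = 0 then 1 else 0) + (if p = 1 \<and> q = 1 then -1 else 0)"
  by (auto simp: ex_coeff_def ex_coeff0_def)

lemma ex_coeff_02:
  "ex_coeff 0 p q 0 2 = (if p = 3 \<and> q = 0 then 1 else 0)"
  "ex_coeff (Suc 0) p q 0 2 = (if p = 1 \<and> q = 0 then -1 else 0) + (if p = 2 \<and> q = 1 then 1 else 0)"
  by (auto simp: ex_coeff_def ex_coeff0_def)

lemma word_induct_2 [consumes 1, case_names Nil zero one]:
  assumes "set js \<subseteq> {..<2::nat}" and "P []"
    and "\<And>js. set js \<subseteq> {..<2} \<Longrightarrow> P js \<Longrightarrow> P (0 # js)"
    and "\<And>js. set js \<subseteq> {..<2} \<Longrightarrow> P js \<Longrightarrow> P (Suc 0 # js)"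
  shows "P js"
  using assms(1)
proof (induction js)
  case (Cons j js)
  then have "j = 0 \<or> j = Suc 0" by auto
  with Cons assms(3,4) show ?case by auto
qed (simp add: assms(2))

text \<open>At \<open>y = 0\<close> the series \<open>F\<close> is \<open>x\<close>. Here, as for
  \<open>y1\<close>, \<open>y2\<close> and \<open>y2^2\<close> below, a word enters only through its
  letter counts, so that sums over words reduce to counting.\<close>

lemma ex_word_coeff_00:
  assumes "set js \<subseteq> {..<2}"
  shows "ex_word_coeff js p q 0 0 = (if p = count_list js 0 \<and> q = count_list js 1 then 1 else 0)"
  using assms
proof (induction js arbitrary: p q rule: word_induct_2)
  case (zero js)
  then show ?case by (auto simp: ex_word_coeff_Cons ex_coeff_00 sum_delta2)
next
  case (one js)
  then show ?case by (auto simp: ex_word_coeff_Cons ex_coeff_00 sum_delta2)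
qed (auto simp: ex_word_coeff_Nil)

text \<open>The coefficients of \<open>x1^p x2^q y^b\<close> in \<open>F1(x,y)^c F2(x,y)^d\<close>, where \<open>y^b\<close> is \<open>y1\<close>, \<open>y2\<close> and
  \<open>y2^2\<close> respectively.\<close>
definition mono_coeff_10 :: "nat \<Rightarrow> nat \<Rightarrow> nat \<Rightarrow> nat \<Rightarrow> 'k::field_char_0" where
  "mono_coeff_10 c d p q =
      (if p + 1 = c \<and> q = d then of_nat c else 0)
    - (if p = c \<and> q = d + 1 then of_nat (c + d) else 0)"

definition mono_coeff_01 :: "nat \<Rightarrow> nat \<Rightarrow> nat \<Rightarrow> nat \<Rightarrow> 'k::field_char_0" where
  "mono_coeff_01 c d p q =
      (if p = c \<and> q + 1 = d then of_nat d else 0)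
    - (if p = c + 1 \<and> q = d then of_nat (c + d) else 0)"

definition mono_coeff_02 :: "nat \<Rightarrow> nat \<Rightarrow> nat \<Rightarrow> nat \<Rightarrow> 'k::field_char_0" where
  "mono_coeff_02 c d p q =
      (if p = c \<and> q + 2 = d then of_nat d * (of_nat d - 1) / 2 else 0)
    - (if p = c + 1 \<and> q + 1 = d then of_nat d * of_nat (c + d) else 0)
    + (if p = c + 2 \<and> q = d then of_nat (c + d) * (of_nat (c + d) + 1) / 2 else 0)"

text \<open>Multiplication by \<open>F1 = x1 - x1^2 y2 + x1^3 y2^2 + ...\<close> (at
  \<open>y1 = 0\<close>). The guards repeat the shape that the recursion on words produces, so that
  the two sides match literally there.\<close>

lemma mono_coeff_02_Suc_left:
  "(mono_coeff_02 (Suc c) d p q :: 'k::field_char_0) =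
    (if 1 \<le> p then mono_coeff_02 c d (p - 1) q else 0)
    + (if 2 \<le> p then - mono_coeff_01 c d (p - 2) q else 0)
    + (if 3 \<le> p then (if p - 3 = c \<and> q = d then 1 else 0) else 0)"
proof -
  \<comment> \<open>The three terms of \<open>mono_coeff_02\<close> have disjoint supports; away
    from them every summand vanishes.\<close>
  consider "p = c + 1" "d = q + 2" | "p = c + 2" "d = q + 1" | "p = c + 3" "d = q"
    | "p \<noteq> c + 1 \<or> q + 2 \<noteq> d" "p \<noteq> c + 2 \<or> q + 1 \<noteq> d" "p \<noteq> c + 3 \<or> q \<noteq> d"
    by auto
  then show ?thesis
  proof cases
    case 4
    have "mono_coeff_02 (Suc c) d p q = (0::'k)" using 4 by (auto simp: mono_coeff_02_def)
    moreover have "(if 1 \<le> p then mono_coeff_02 c d (p - 1) q else 0) = (0::'k)"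
      using 4 by (auto simp: mono_coeff_02_def)
    moreover have "(if 2 \<le> p then - mono_coeff_01 c d (p - 2) q else 0) = (0::'k)"
      using 4 by (auto simp: mono_coeff_01_def)
    moreover have "(if 3 \<le> p then (if p - 3 = c \<and> q = d then 1 else 0) else 0) = (0::'k)"
      using 4 by auto
    ultimately show ?thesis by (simp only: add_0)
  qed (auto simp: mono_coeff_01_def mono_coeff_02_def field_simps)
qed

text \<open>Multiplication by \<open>F2 = x2 + (1 - x1 x2) y2 + (x1^2 x2 - x1) y2^2 + ...\<close>
  (at \<open>y1 = 0\<close>), again in the shape of the recursion.\<close>

lemma mono_coeff_02_Suc_right:
  "(mono_coeff_02 c (Suc d) p q :: 'k::field_char_0) =
    (if 1 \<le> q then mono_coeff_02 c d p (q - 1) else 0)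
    + (mono_coeff_01 c d p q + (if 1 \<le> p \<and> 1 \<le> q then - mono_coeff_01 c d (p - 1) (q - 1) else 0))
    + ((if 1 \<le> p then - (if p - 1 = c \<and> q = d then 1 else 0) else 0)
      + (if 2 \<le> p \<and> 1 \<le> q then (if p - 2 = c \<and> q - 1 = d then 1 else 0) else 0))"
proof -
  consider "p = c" "d = q + 1" | "p = c + 1" "d = q" | "p = c + 2" "q = d + 1"
    | "p \<noteq> c \<or> q + 1 \<noteq> d" "p \<noteq> c + 1 \<or> q \<noteq> d" "p \<noteq> c + 2 \<or> q \<noteq> d + 1"
    by auto
  then show ?thesis
  proof cases
    case 4
    have "mono_coeff_02 c (Suc d) p q = (0::'k)" using 4 by (auto simp: mono_coeff_02_def)
    moreover have "(if 1 \<le> q then mono_coeff_02 c d p (q - 1) else 0) = (0::'k)"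
      using 4 by (auto simp: mono_coeff_02_def)
    moreover have "mono_coeff_01 c d p q = (0::'k)"
      using 4 by (auto simp: mono_coeff_01_def)
    moreover have "(if 1 \<le> p \<and> 1 \<le> q then - mono_coeff_01 c d (p - 1) (q - 1) else 0) = (0::'k)"
      using 4 by (auto simp: mono_coeff_01_def)
    moreover have "(if 1 \<le> p then - (if p - 1 = c \<and> q = d then 1 else 0) else 0) = (0::'k)"
      using 4 by auto
    moreover have "(if 2 \<le> p \<and> 1 \<le> q then (if p - 2 = c \<and> q - 1 = d then 1 else 0) else 0) = (0::'k)"
      using 4 by auto
    ultimately show ?thesis by (simp only: add_0)
  next
    case 1
    then show ?thesis by (cases q) (auto simp: mono_coeff_01_def mono_coeff_02_def field_simps)
  next
    case 2
    then show ?thesis by (cases q) (auto simp: mono_coeff_01_def mono_coeff_02_def field_simps)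
  next
    case 3
    then show ?thesis by (simp add: mono_coeff_01_def mono_coeff_02_def field_simps)
  qed
qed

text \<open>Leibniz rule: \<open>y1\<close> comes either from the first factor or from the rest of
  the word, the other being taken at \<open>y = 0\<close>.\<close>

lemma ex_word_coeff_10:
  assumes "set js \<subseteq> {..<2}"
  shows "ex_word_coeff js p q 1 0 = mono_coeff_10 (count_list js 0) (count_list js 1) p q"
  using assms unfolding mono_coeff_10_def
proof (induction js arbitrary: p q rule: word_induct_2)
  case (zero js)
  then show ?case
    by (simp add: ex_word_coeff_Cons ex_coeff_00 ex_coeff_10 distrib_right sum.distrib sum_delta2
        ex_word_coeff_00, auto)
next
  case (one js)
  then show ?case
    by (simp add: ex_word_coeff_Cons ex_coeff_00 ex_coeff_10 distrib_right sum.distrib sum_delta2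
        ex_word_coeff_00, auto)
qed (auto simp: ex_word_coeff_Nil)

lemma ex_word_coeff_01:
  assumes "set js \<subseteq> {..<2}"
  shows "ex_word_coeff js p q 0 1 = mono_coeff_01 (count_list js 0) (count_list js 1) p q"
  using assms unfolding mono_coeff_01_def
proof (induction js arbitrary: p q rule: word_induct_2)
  case (zero js)
  then show ?case
    by (simp add: ex_word_coeff_Cons ex_coeff_00 ex_coeff_01 distrib_right sum.distrib sum_delta2
        ex_word_coeff_00, auto)
next
  case (one js)
  then show ?case
    by (simp add: ex_word_coeff_Cons ex_coeff_00 ex_coeff_01 distrib_right sum.distrib sum_delta2
        ex_word_coeff_00, auto)
qed (auto simp: ex_word_coeff_Nil)

text \<open>The exponent of \<open>y2\<close> splits as 0 + 2, 1 + 1 or 2 + 0 between the first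
  factor and the rest, hence the use of the coefficients at 1 and \<open>y2\<close>.\<close>

lemma ex_word_coeff_02:
  assumes "set js \<subseteq> {..<2}"
  shows "(ex_word_coeff js p q 0 2 :: 'k::field_char_0) = mono_coeff_02 (count_list js 0) (count_list js 1) p q"
  using assms
proof (induction js arbitrary: p q rule: word_induct_2)
  case Nil
  show ?case by (simp add: ex_word_coeff_Nil mono_coeff_02_def)
next
  case (zero js)
  have I: "{..2::nat} = {0, Suc 0, 2}" by auto
  have "(ex_word_coeff (0 # js) p q 0 2 :: 'k) =
    (if 1 \<le> p then ex_word_coeff js (p - 1) q 0 2 else 0)
    + (if 2 \<le> p then - ex_word_coeff js (p - 2) q 0 1 else 0)
    + (if 3 \<le> p then ex_word_coeff js (p - 3) q 0 0 else 0)"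
    unfolding ex_word_coeff_Cons[of 0, simplified] I
    by (simp add: ex_coeff_00 ex_coeff_01 ex_coeff_02 sum_delta2)
  also have "\<dots> = mono_coeff_02 (Suc (count_list js 0)) (count_list js 1) p q"
    unfolding zero.IH ex_word_coeff_01[OF zero.hyps]
      ex_word_coeff_00[OF zero.hyps] mono_coeff_02_Suc_left ..
  finally show ?case by simp
next
  case (one js)
  have I: "{..2::nat} = {0, Suc 0, 2}" by auto
  have "(ex_word_coeff (Suc 0 # js) p q 0 2 :: 'k) =
    (if 1 \<le> q then ex_word_coeff js p (q - 1) 0 2 else 0)
    + (ex_word_coeff js p q 0 1 + (if 1 \<le> p \<and> 1 \<le> q then - ex_word_coeff js (p - 1) (q - 1) 0 1 else 0))
    + ((if 1 \<le> p then - ex_word_coeff js (p - 1) q 0 0 else 0)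
      + (if 2 \<le> p \<and> 1 \<le> q then ex_word_coeff js (p - 2) (q - 1) 0 0 else 0))"
    unfolding ex_word_coeff_Cons[of "Suc 0", simplified] I
    by (simp add: ex_coeff_00 ex_coeff_01 ex_coeff_02 sum_delta2 distrib_right sum.distrib)
  also have "\<dots> = mono_coeff_02 (count_list js 0) (Suc (count_list js 1)) p q"
    unfolding one.IH ex_word_coeff_01[OF one.hyps]
      ex_word_coeff_00[OF one.hyps] mono_coeff_02_Suc_right ..
  finally show ?case by simp
qed

section \<open>Coefficients of the composite \<open>f(F(x,y))\<close>\<close>

definition ord_coeff :: "(mi \<Rightarrow> 'k::field_char_0) \<Rightarrow> nat \<Rightarrow> nat \<Rightarrow> 'k" where
  "ord_coeff f u v = f (mi2 u v) / (fact u * fact v)"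

text \<open>All words with the content of \<open>c\<close> contribute equally, and their number
  cancels the \<open>1/r!\<close> of \<open>fprime\<close> up to the two factorials that
  \<open>ord_coeff\<close> absorbs.\<close>

lemma mprime_Fex:
  assumes M: "\<And>js. set js \<subseteq> {..<2} \<Longrightarrow>
      (ex_word_coeff js p q r s :: 'k::field_char_0) = M (count_list js 0) (count_list js 1)"
    and c: "c \<in> mis_le 2 (p + q + r + s)"
  shows "mprime 2 Fex (mi2 p q) (mi2 r s) c =
    fact p * fact q * fact r * fact s * M (c 0) (c 1) / (fact (c 0) * fact (c 1))"
proof -
  have c2: "c \<in> mis 2" and deg: "mi_deg c = c 0 + c 1" "c 0 + c 1 \<le> p + q + r + s"
    using c by (auto simp: mis_le_def mi_deg_mis2)
  have card: "of_nat (card (words 2 c)) = (fact (c 0 + c 1) / (fact (c 0) * fact (c 1)) :: 'k)"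
    using card_words_2[OF c2, THEN arg_cong[of _ _ "of_nat :: nat \<Rightarrow> 'k"]] by (simp add: field_simps)
  have "(\<Sum>js\<in>words 2 c. ex_word_coeff js p q r s) = (\<Sum>js\<in>words 2 c. M (c 0) (c 1))"
    by (intro sum.cong refl) (auto simp: words_def M)
  then have "mprime 2 Fex (mi2 p q) (mi2 r s) c = of_nat (fact p * fact q * fact r * fact s)
      / fact (c 0 + c 1) * (of_nat (card (words 2 c)) * M (c 0) (c 1))"
    using deg by (simp add: mprime_def fprime_eq[OF c2] mi_deg_pair_mi2 mi_fact_pair_mi2)
  also have "\<dots> = fact p * fact q * fact r * fact s * M (c 0) (c 1) / (fact (c 0) * fact (c 1))"
    unfolding card by (simp add: field_simps)
  finally show ?thesis .
qed

text \<open>The final sum is the coefficient of \<open>x1^p x2^q y1^r y2^s\<close> in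
  \<open>f(F(x,y))\<close>, where \<open>M u v\<close> is that coefficient in
  \<open>F1^u F2^v\<close>.\<close>

lemma sum_mprime_Fex:
  assumes M: "\<And>js. set js \<subseteq> {..<2} \<Longrightarrow>
      (ex_word_coeff js p q r s :: 'k::field_char_0) = M (count_list js 0) (count_list js 1)"
  shows "(\<Sum>c\<in>mis_le 2 (mi_deg (mi2 p q) + mi_deg (mi2 r s)). mprime 2 Fex (mi2 p q) (mi2 r s) c * f c)
    = fact p * fact q * fact r * fact s *
      (\<Sum>(u, v)\<in>{(u, v). u + v \<le> p + q + r + s}. M u v * ord_coeff f u v)"
proof -
  have "(\<Sum>c\<in>mis_le 2 (p + q + r + s). mprime 2 Fex (mi2 p q) (mi2 r s) c * f c)
    = (\<Sum>c\<in>mis_le 2 (p + q + r + s). fact p * fact q * fact r * fact s *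
        (M (c 0) (c 1) * ord_coeff f (c 0) (c 1)))"
  proof (intro sum.cong refl)
    fix c assume c: "c \<in> mis_le 2 (p + q + r + s)"
    then have "mi2 (c 0) (c 1) = c" using mi2_eq[of c] by (simp add: mis_le_def)
    then show "mprime 2 Fex (mi2 p q) (mi2 r s) c * f c =
        fact p * fact q * fact r * fact s * (M (c 0) (c 1) * ord_coeff f (c 0) (c 1))"
      using mprime_Fex[where M = M, OF M c] by (simp add: ord_coeff_def)
  qed
  also have "\<dots> = fact p * fact q * fact r * fact s *
      (\<Sum>(u, v)\<in>{(u, v). u + v \<le> p + q + r + s}. M u v * ord_coeff f u v)"
    unfolding sum_distrib_left[symmetric] sum_mis_le_2[of "\<lambda>u v. M u v * ord_coeff f u v"] ..
  finally show ?thesis by (simp add: mi_deg_mi2 add.assoc)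
qed

text \<open>The condition \<open>C\<close> is kept apart from \<open>u = a\<close> and
  \<open>v = b\<close> because \<open>a\<close> and \<open>b\<close> will involve truncated
  subtraction, which would give false solutions at the boundary.\<close>

lemma sum_pair_delta:
  fixes g :: "nat \<Rightarrow> nat \<Rightarrow> 'k::comm_ring_1"
  assumes "\<And>u v. P u v \<longleftrightarrow> C \<and> u = a \<and> v = b" and "C \<Longrightarrow> a + b \<le> d"
  shows "(\<Sum>(u, v)\<in>{(u, v). u + v \<le> d}. (if P u v then w u v else 0) * g u v)
    = (if C then w a b * g a b else 0)"
proof -
  have fin: "finite {(u, v). u + v \<le> d}"
    by (rule finite_subset[of _ "{..d} \<times> {..d}"]) auto
  have "(\<Sum>(u, v)\<in>{(u, v). u + v \<le> d}. (if P u v then w u v else 0) * g u v)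
      = (\<Sum>x\<in>{(u, v). u + v \<le> d}. if x = (a, b) then (if C then w a b * g a b else 0) else 0)"
    by (intro sum.cong) (auto simp: assms(1) split: if_splits)
  also have "\<dots> = (if C then w a b * g a b else 0)"
    using fin assms(2) by simp
  finally show ?thesis .
qed

section \<open>The induced operators on power series\<close>

text \<open>On coefficient sequences: \<open>D1 = d1 - x2 E\<close>, \<open>D2 = d2 - x1 E\<close>, and \<open>S2\<close> extracts the coefficient of
  \<open>y2^2\<close> from \<open>g(F(x,y))\<close>.\<close>
definition D1 :: "(nat \<Rightarrow> nat \<Rightarrow> 'k::field_char_0) \<Rightarrow> nat \<Rightarrow> nat \<Rightarrow> 'k" where
  "D1 g p q = of_nat (p + 1) * g (p + 1) q - (if q \<noteq> 0 then of_nat (p + (q - 1)) * g p (q - 1) else 0)"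

definition D2 :: "(nat \<Rightarrow> nat \<Rightarrow> 'k::field_char_0) \<Rightarrow> nat \<Rightarrow> nat \<Rightarrow> 'k" where
  "D2 g p q = of_nat (q + 1) * g p (q + 1) - (if p \<noteq> 0 then of_nat (p - 1 + q) * g (p - 1) q else 0)"

definition S2 :: "(nat \<Rightarrow> nat \<Rightarrow> 'k::field_char_0) \<Rightarrow> nat \<Rightarrow> nat \<Rightarrow> 'k" where
  "S2 g p q = of_nat (q + 2) * (of_nat (q + 2) - 1) / 2 * g p (q + 2)
    - (if p \<noteq> 0 then of_nat (q + 1) * of_nat (p - 1 + (q + 1)) * g (p - 1) (q + 1) else 0)
    + (if 2 \<le> p then of_nat (p - 2 + q) * (of_nat (p - 2 + q) + 1) / 2 * g (p - 2) q else 0)"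

text \<open>The bound is left as \<open>p + q + 1 + 0\<close> to match \<open>p + q + r + s\<close>
  when the operators are applied to a homomorphism.\<close>

lemma sum_mono_coeff_10:
  "(\<Sum>(u, v)\<in>{(u, v). u + v \<le> p + q + 1 + 0}. mono_coeff_10 u v p q * g u v) = D1 g p q"
proof -
  let ?S = "{(u, v). u + v \<le> p + q + 1 + 0}"
  have "(\<Sum>(u, v)\<in>?S. mono_coeff_10 u v p q * g u v) =
     (\<Sum>(u, v)\<in>?S. (if p + 1 = u \<and> q = v then of_nat u else 0) * g u v)
   - (\<Sum>(u, v)\<in>?S. (if p = u \<and> q = v + 1 then of_nat (u + v) else 0) * g u v)"
    unfolding mono_coeff_10_def by (simp only: left_diff_distrib case_prod_unfold sum_subtractf)
  also have "(\<Sum>(u, v)\<in>?S. (if p + 1 = u \<and> q = v then of_nat u else 0) * g u v) =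
      (if True then of_nat (p + 1) * g (p + 1) q else 0)"
    by (rule sum_pair_delta) auto
  also have "(\<Sum>(u, v)\<in>?S. (if p = u \<and> q = v + 1 then of_nat (u + v) else 0) * g u v) =
      (if q \<noteq> 0 then of_nat (p + (q - 1)) * g p (q - 1) else 0)"
    by (rule sum_pair_delta) auto
  finally show ?thesis by (simp add: D1_def)
qed

lemma sum_mono_coeff_01:
  "(\<Sum>(u, v)\<in>{(u, v). u + v \<le> p + q + 0 + 1}. mono_coeff_01 u v p q * g u v) = D2 g p q"
proof -
  let ?S = "{(u, v). u + v \<le> p + q + 0 + 1}"
  have "(\<Sum>(u, v)\<in>?S. mono_coeff_01 u v p q * g u v) =
     (\<Sum>(u, v)\<in>?S. (if p = u \<and> q + 1 = v then of_nat v else 0) * g u v)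
   - (\<Sum>(u, v)\<in>?S. (if p = u + 1 \<and> q = v then of_nat (u + v) else 0) * g u v)"
    unfolding mono_coeff_01_def by (simp only: left_diff_distrib case_prod_unfold sum_subtractf)
  also have "(\<Sum>(u, v)\<in>?S. (if p = u \<and> q + 1 = v then of_nat v else 0) * g u v) =
      (if True then of_nat (q + 1) * g p (q + 1) else 0)"
    by (rule sum_pair_delta) auto
  also have "(\<Sum>(u, v)\<in>?S. (if p = u + 1 \<and> q = v then of_nat (u + v) else 0) * g u v) =
      (if p \<noteq> 0 then of_nat (p - 1 + q) * g (p - 1) q else 0)"
    by (rule sum_pair_delta) auto
  finally show ?thesis by (simp add: D2_def)
qed

lemma sum_mono_coeff_02:
  "(\<Sum>(u, v)\<in>{(u, v). u + v \<le> p + q + 0 + 2}. mono_coeff_02 u v p q * g u v) = S2 g p q"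
proof -
  let ?S = "{(u, v). u + v \<le> p + q + 0 + 2}"
  have "(\<Sum>(u, v)\<in>?S. mono_coeff_02 u v p q * g u v) =
     (\<Sum>(u, v)\<in>?S. (if p = u \<and> q + 2 = v then of_nat v * (of_nat v - 1) / 2 else 0) * g u v)
   - (\<Sum>(u, v)\<in>?S. (if p = u + 1 \<and> q + 1 = v then of_nat v * of_nat (u + v) else 0) * g u v)
   + (\<Sum>(u, v)\<in>?S. (if p = u + 2 \<and> q = v then of_nat (u + v) * (of_nat (u + v) + 1) / 2 else 0) * g u v)"
    unfolding mono_coeff_02_def
    by (simp only: left_diff_distrib distrib_right case_prod_unfold sum_subtractf sum.distrib)
  also have "(\<Sum>(u, v)\<in>?S. (if p = u \<and> q + 2 = v then of_nat v * (of_nat v - 1) / 2 else 0) * g u v) =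
      (if True then of_nat (q + 2) * (of_nat (q + 2) - 1) / 2 * g p (q + 2) else 0)"
    by (rule sum_pair_delta) auto
  also have "(\<Sum>(u, v)\<in>?S. (if p = u + 1 \<and> q + 1 = v then of_nat v * of_nat (u + v) else 0) * g u v) =
      (if p \<noteq> 0 then of_nat (q + 1) * of_nat (p - 1 + (q + 1)) * g (p - 1) (q + 1) else 0)"
    by (rule sum_pair_delta) auto
  also have "(\<Sum>(u, v)\<in>?S. (if p = u + 2 \<and> q = v then of_nat (u + v) * (of_nat (u + v) + 1) / 2 else 0) * g u v) =
      (if 2 \<le> p then of_nat (p - 2 + q) * (of_nat (p - 2 + q) + 1) / 2 * g (p - 2) q else 0)"
    by (rule sum_pair_delta) auto
  finally show ?thesis by (simp add: S2_def)
qed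

definition T2 :: "(nat \<Rightarrow> nat \<Rightarrow> 'k::field_char_0) \<Rightarrow> nat \<Rightarrow> nat \<Rightarrow> 'k" where
  "T2 g p q = D2 (D2 g) p q - 2 * S2 g p q"

definition raise :: "(nat \<Rightarrow> nat \<Rightarrow> 'k::field_char_0) \<Rightarrow> nat \<Rightarrow> nat \<Rightarrow> 'k" where
  "raise g p q = (D1 (T2 g) p q - T2 (D1 g) p q - D2 g p q) / 2"

text \<open>The operator is \<open>x1 d2\<close>: the second-order parts of \<open>D2^2\<close> and
  \<open>2 S2\<close> cancel, and the rest is \<open>x1 [d2, E]\<close> with
  \<open>[d2, E] = d2\<close>.\<close>

lemma T2_eq: "T2 g p q = (if p \<noteq> 0 then of_nat (q + 1) * g (p - 1) (q + 1) else 0)"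
proof -
  consider "p = 0" | "p = 1" | p' where "p = Suc (Suc p')"
    by (metis One_nat_def not0_implies_Suc)
  then show ?thesis
    by cases (simp_all add: T2_def D2_def S2_def field_simps)
qed

text \<open>The operator is \<open>x1 E\<close>, since \<open>[d1 - x2 E, x1 d2] = d2 + x1 E\<close>
  and subtracting \<open>D2\<close> leaves \<open>2 x1 E\<close>.\<close>

lemma raise_eq: "raise g p q = (if p \<noteq> 0 then of_nat (p - 1 + q) * g (p - 1) q else 0)"
  by (cases p; cases q) (simp_all add: raise_def T2_eq D1_def D2_def field_simps)


text \<open>The constant term is disregarded: it is not preserved, but the operators annihilate constants.\<close>
definition spanned :: "nat \<Rightarrow> (nat \<Rightarrow> nat \<Rightarrow> nat \<Rightarrow> 'k::field_char_0) \<Rightarrow> (nat \<Rightarrow> nat \<Rightarrow> 'k) \<Rightarrow> bool" where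
  "spanned m F g \<longleftrightarrow> (\<exists>k. \<forall>p q. p + q \<noteq> 0 \<longrightarrow> g p q = (\<Sum>i<m. k i * F i p q))"

lemma spanned_self: "l < m \<Longrightarrow> spanned m F (F l)"
  unfolding spanned_def by (intro exI[of _ "\<lambda>i. if i = l then 1 else 0"]) (simp add: if_distrib[of "\<lambda>x. x * _"] cong: if_cong)

lemma spanned_diff:
  assumes "spanned m F g" "spanned m F h" shows "spanned m F (\<lambda>p q. g p q - h p q)"
proof -
  obtain k k' where "\<forall>p q. p + q \<noteq> 0 \<longrightarrow> g p q = (\<Sum>i<m. k i * F i p q)"
    "\<forall>p q. p + q \<noteq> 0 \<longrightarrow> h p q = (\<Sum>i<m. k' i * F i p q)"
    using assms unfolding spanned_def by blast
  then show ?thesis unfolding spanned_def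
    by (intro exI[of _ "\<lambda>i. k i - k' i"]) (simp add: left_diff_distrib sum_subtractf)
qed

lemma spanned_scale:
  assumes "spanned m F g" shows "spanned m F (\<lambda>p q. c * g p q)"
proof -
  obtain k where "\<forall>p q. p + q \<noteq> 0 \<longrightarrow> g p q = (\<Sum>i<m. k i * F i p q)"
    using assms unfolding spanned_def by blast
  then show ?thesis unfolding spanned_def
    by (intro exI[of _ "\<lambda>i. c * k i"]) (simp add: sum_distrib_left mult.assoc)
qed

text \<open>Linearity modulo constants: \<open>g\<close> need not match the combination at (0,0), so
  \<open>Q\<close> must also annihilate constants. This lets operators be composed on
  \<open>spanned\<close> series.\<close>

definition lin_op :: "((nat \<Rightarrow> nat \<Rightarrow> 'k::field_char_0) \<Rightarrow> nat \<Rightarrow> nat \<Rightarrow> 'k) \<Rightarrow> bool" where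
  "lin_op Q \<longleftrightarrow> (\<forall>m F k g. (\<forall>p q. p + q \<noteq> 0 \<longrightarrow> g p q = (\<Sum>i<m. k i * F i p q)) \<longrightarrow>
     (\<forall>p q. Q g p q = (\<Sum>i<(m::nat). k i * Q (F i) p q)))"

lemma spanned_lin_op:
  assumes "lin_op Q" and "\<And>i. i < m \<Longrightarrow> spanned m F (Q (F i))" and "spanned m F g"
  shows "spanned m F (Q g)"
proof -
  obtain k where k: "\<forall>p q. p + q \<noteq> 0 \<longrightarrow> g p q = (\<Sum>i<m. k i * F i p q)"
    using assms(3) unfolding spanned_def by blast
  obtain K where K: "\<And>i p q. i < m \<Longrightarrow> p + q \<noteq> 0 \<Longrightarrow> Q (F i) p q = (\<Sum>j<m. K i j * F j p q)"
    using assms(2) unfolding spanned_def by metis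
  have "Q g p q = (\<Sum>j<m. (\<Sum>i<m. k i * K i j) * F j p q)" if "p + q \<noteq> 0" for p q
  proof -
    have "Q g p q = (\<Sum>i<m. k i * Q (F i) p q)"
      using assms(1) k unfolding lin_op_def by blast
    also have "\<dots> = (\<Sum>i<m. \<Sum>j<m. k i * K i j * F j p q)"
      using that by (intro sum.cong refl) (simp add: K sum_distrib_left mult.assoc)
    also have "\<dots> = (\<Sum>j<m. (\<Sum>i<m. k i * K i j) * F j p q)"
      by (subst sum.swap) (simp add: sum_distrib_right)
    finally show ?thesis .
  qed
  then show ?thesis unfolding spanned_def by (intro exI allI impI)
qed

text \<open>The eigenvalue \<open>p + q\<close> of \<open>E\<close> vanishes exactly where
  \<open>g\<close> is unconstrained.\<close>

lemma of_nat_mult_comb: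
  fixes g :: "nat \<Rightarrow> nat \<Rightarrow> 'k::field_char_0"
  assumes "\<forall>p q. p + q \<noteq> 0 \<longrightarrow> g p q = (\<Sum>i<(m::nat). k i * F i p q)"
  shows "of_nat (p + q) * g p q = (\<Sum>i<m. k i * (of_nat (p + q) * F i p q))"
proof (cases "p + q = 0")
  case False
  then have "g p q = (\<Sum>i<m. k i * F i p q)" using assms by blast
  then show ?thesis by (simp only: sum_distrib_left mult.left_commute)
qed simp

lemma lin_op_D1: "lin_op D1"
  unfolding lin_op_def
proof (intro allI impI)
  fix m :: nat and F k and g :: "nat \<Rightarrow> nat \<Rightarrow> 'k::field_char_0" and p q
  assume *: "\<forall>p q. p + q \<noteq> 0 \<longrightarrow> g p q = (\<Sum>i<m. k i * F i p q)"
  have "g (p + 1) q = (\<Sum>i<m. k i * F i (p + 1) q)" using * by simp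
  then show "D1 g p q = (\<Sum>i<m. k i * D1 (F i) p q)"
    unfolding D1_def of_nat_mult_comb[OF *, of p "q - 1"]
    by (cases "q = 0") (simp_all only: if_True if_False simp_thms right_diff_distrib sum_subtractf sum_distrib_left mult.left_commute diff_zero)
qed

lemma lin_op_D2: "lin_op D2"
  unfolding lin_op_def
proof (intro allI impI)
  fix m :: nat and F k and g :: "nat \<Rightarrow> nat \<Rightarrow> 'k::field_char_0" and p q
  assume *: "\<forall>p q. p + q \<noteq> 0 \<longrightarrow> g p q = (\<Sum>i<m. k i * F i p q)"
  have "g p (q + 1) = (\<Sum>i<m. k i * F i p (q + 1))" using * by simp
  then show "D2 g p q = (\<Sum>i<m. k i * D2 (F i) p q)"
    unfolding D2_def of_nat_mult_comb[OF *, of "p - 1" q]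
    by (cases "p = 0") (simp_all only: if_True if_False simp_thms right_diff_distrib sum_subtractf sum_distrib_left mult.left_commute diff_zero)
qed

text \<open>By \<open>T2_eq\<close> the operator reads \<open>g\<close> only at second index
  \<open>q + 1\<close>, hence never the constant term.\<close>

lemma lin_op_T2: "lin_op T2"
  unfolding lin_op_def
proof (intro allI impI)
  fix m :: nat and F k and g :: "nat \<Rightarrow> nat \<Rightarrow> 'k::field_char_0" and p q
  assume "\<forall>p q. p + q \<noteq> 0 \<longrightarrow> g p q = (\<Sum>i<m. k i * F i p q)"
  then have "g (p - 1) (q + 1) = (\<Sum>i<m. k i * F i (p - 1) (q + 1))" by simp
  then show "T2 g p q = (\<Sum>i<m. k i * T2 (F i) p q)"
    unfolding T2_eq
    by (cases "p = 0") (simp_all only: if_True if_False simp_thms sum_distrib_left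
        mult.left_commute mult_zero_right sum.neutral_const)
qed

lemma spanned_raise:
  fixes F :: "nat \<Rightarrow> nat \<Rightarrow> nat \<Rightarrow> 'k::field_char_0"
  assumes D1: "\<And>i. i < m \<Longrightarrow> spanned m F (D1 (F i))"
    and D2: "\<And>i. i < m \<Longrightarrow> spanned m F (D2 (F i))"
    and S2: "\<And>i. i < m \<Longrightarrow> spanned m F (S2 (F i))"
    and g: "spanned m F g"
  shows "spanned m F (raise g)"
proof -
  \<comment> \<open>Stability under \<open>S2\<close> is given on the generators only, so
    \<open>T2\<close> is treated there first and then extended to the span by linearity.\<close>
  have T2F: "spanned m F (T2 (F i))" if "i < m" for i
    unfolding T2_def[abs_def]
    by (intro spanned_diff spanned_scale S2 spanned_lin_op[OF lin_op_D2 D2] spanned_self that)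
  note T2 = spanned_lin_op[OF lin_op_T2 T2F]
  have "spanned m F (\<lambda>p q. (1 / 2) * (D1 (T2 g) p q - T2 (D1 g) p q - D2 g p q))"
    by (intro spanned_scale spanned_diff T2 spanned_lin_op[OF lin_op_D1 D1]
        spanned_lin_op[OF lin_op_D2 D2] g)
  then show ?thesis by (simp add: raise_def[abs_def])
qed

text \<open>Compare coefficients of \<open>x1^p x2^q y1^r y2^s\<close> in the homomorphism equation:
  the left side gives \<open>Q\<close>, the right side a combination of the components of
  \<open>psi\<close> independent of \<open>p\<close> and \<open>q\<close>.\<close>

lemma spanned_hom_op:
  fixes psi :: "mi \<Rightarrow> nat \<Rightarrow> 'k::field_char_0"
  assumes hom: "is_hom 2 m Fex (Gmul m mul) psi" and "l < m" and rs: "r + s \<noteq> 0"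
    and M: "\<And>js p q. set js \<subseteq> {..<2} \<Longrightarrow>
      (ex_word_coeff js p q r s :: 'k) = M (count_list js 0) (count_list js 1) p q"
    and Q: "\<And>g p q. (\<Sum>(u, v)\<in>{(u, v). u + v \<le> p + q + r + s}. M u v p q * g u v) = Q g p q"
  shows "spanned m (\<lambda>i. ord_coeff (\<lambda>a. psi a i)) (Q (ord_coeff (\<lambda>a. psi a l)))"
proof -
  have nz: "mi2 p q \<noteq> mi_zero" if "p + q \<noteq> 0" for p q
    using that mi2_apply[of p q] by (auto simp: mi_zero_def)
  \<comment> \<open>Component \<open>l\<close> of \<open>e_i * psi(e^b)\<close> for
    \<open>b = (r, s)\<close>, rescaled to ordinary coefficients.\<close>
  define X where "X i = (\<Sum>j<m. psi (mi2 r s) j * mul i j l) / (fact r * fact s)" for i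
  have "Q (ord_coeff (\<lambda>a. psi a l)) p q = (\<Sum>i<m. X i * ord_coeff (\<lambda>a. psi a i) p q)"
    if "p + q \<noteq> 0" for p q
  proof -
    have "fact p * fact q * fact r * fact s * Q (ord_coeff (\<lambda>a. psi a l)) p q
      = (\<Sum>i<m. psi (mi2 p q) i * (\<Sum>j<m. psi (mi2 r s) j * mul i j l))"
      using hom_Gmul_eq[OF hom \<open>l < m\<close> mi2_in_mis nz[OF that] mi2_in_mis nz[OF rs]]
        sum_mprime_Fex[where M = "\<lambda>c d. M c d p q" and f = "\<lambda>a. psi a l", OF M]
      by (simp add: Q)
    also have "\<dots> = (\<Sum>i<m. fact p * fact q * fact r * fact s * (X i * ord_coeff (\<lambda>a. psi a i) p q))"
      by (intro sum.cong refl) (simp add: X_def ord_coeff_def)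
    also have "\<dots> = fact p * fact q * fact r * fact s * (\<Sum>i<m. X i * ord_coeff (\<lambda>a. psi a i) p q)"
      by (simp only: sum_distrib_left)
    finally show ?thesis by simp
  qed
  then show ?thesis unfolding spanned_def by blast
qed

section \<open>Iterates of \<open>x1 E\<close> on the axis \<open>x2 = 0\<close> and the
  contradiction\<close>

text \<open>On the axis \<open>x1 E\<close> sends \<open>x1^j\<close> to \<open>j x1^(j+1)\<close>,
  so \<open>k\<close> steps from \<open>x1\<close> collect the factor \<open>k!\<close>.\<close>

lemma raise_funpow_diag: "(raise ^^ k) g (Suc k) 0 = fact k * g 1 0"
  by (induction k) (simp_all add: raise_eq algebra_simps)

lemma raise_funpow_below: "0 < j \<Longrightarrow> j \<le> k \<Longrightarrow> (raise ^^ k) g j 0 = 0"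
proof (induction k arbitrary: j)
  case (Suc k)
  show ?case
  \<comment> \<open>At \<open>j = 1\<close> the factor \<open>p - 1 + q\<close> is 0, so the
    constant term of the previous iterate is not carried over.\<close>
  proof (cases "j = 1")
    case False
    then show ?thesis using Suc.prems Suc.IH[of "j - 1"] by (simp add: raise_eq)
  qed (simp add: raise_eq)
qed simp

theorem mainTheorem16:
  shows "\<not> is_linear_fm 2 (Fex :: mi \<Rightarrow> mi \<Rightarrow> nat \<Rightarrow> 'k::field_char_0)"
proof
  assume "is_linear_fm 2 (Fex :: mi \<Rightarrow> mi \<Rightarrow> nat \<Rightarrow> 'k)"
  then obtain m mul and psi :: "mi \<Rightarrow> nat \<Rightarrow> 'k" where
    hom: "is_hom 2 m Fex (Gmul m mul) psi" and
    surj: "\<forall>h :: mi \<Rightarrow> 'k. \<exists>g :: mi \<Rightarrow> 'k. \<forall>a\<in>mis 2.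
          (\<Sum>c\<in>mis_le m (mi_deg a). g c * fprime m psi a c) = h a"
    unfolding is_linear_fm_def by blast
  define F where "F i = ord_coeff (\<lambda>a. psi a i)" for i
  obtain l where l: "l < m" "psi (mi2 1 0) l \<noteq> 0"
    using surj_imp_psi_neq_0[OF hom mi2_in_mis _ surj, of 1 0] by (auto simp: mi_deg_mi2)
  have D1: "spanned m F (D1 (F i))" if "i < m" for i
    unfolding F_def
    by (rule spanned_hom_op[OF hom that, where M = mono_coeff_10 and r = 1 and s = 0])
      (simp, erule ex_word_coeff_10, rule sum_mono_coeff_10)
  have D2: "spanned m F (D2 (F i))" if "i < m" for i
    unfolding F_def
    by (rule spanned_hom_op[OF hom that, where M = mono_coeff_01 and r = 0 and s = 1])
      (simp, erule ex_word_coeff_01, rule sum_mono_coeff_01)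
  have S2: "spanned m F (S2 (F i))" if "i < m" for i
    unfolding F_def
    by (rule spanned_hom_op[OF hom that, where M = mono_coeff_02 and r = 0 and s = 2])
      (simp, erule ex_word_coeff_02, rule sum_mono_coeff_02)
  have "spanned m F ((raise ^^ k) (F l))" for k
    by (induction k) (use l in \<open>auto intro: spanned_self spanned_raise D1 D2 S2\<close>)
  then obtain v where v: "\<And>k p q. p + q \<noteq> 0 \<Longrightarrow> (raise ^^ k) (F l) p q = (\<Sum>i<m. v k i * F i p q)"
    unfolding spanned_def by metis
  \<comment> \<open>There are \<open>m + 1\<close> iterates, with \<open>k\<close> from 0 to
    \<open>m\<close>, but only \<open>m\<close> coordinates.\<close>
  obtain c where c: "\<exists>k\<in>{..m}. c k \<noteq> 0" "\<forall>i<m. (\<Sum>k\<le>m. c k * v k i) = 0"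
    using linear_dependence[of "{..m}" m v] by auto
  have comb: "(\<Sum>k\<le>m. c k * (raise ^^ k) (F l) j 0) = 0" if "j \<noteq> 0" for j
  proof -
    have "(\<Sum>k\<le>m. c k * (raise ^^ k) (F l) j 0) = (\<Sum>k\<le>m. \<Sum>i<m. c k * v k i * F i j 0)"
      using that by (simp add: v sum_distrib_left mult.assoc)
    also have "\<dots> = (\<Sum>i<m. (\<Sum>k\<le>m. c k * v k i) * F i j 0)"
      by (subst sum.swap) (simp add: sum_distrib_right)
    also have "\<dots> = 0" using c(2) by simp
    finally show ?thesis .
  qed
  define n where "n = (LEAST k. k \<le> m \<and> c k \<noteq> 0)"
  have n: "n \<le> m" "c n \<noteq> 0"
    using LeastI_ex[of "\<lambda>k. k \<le> m \<and> c k \<noteq> 0"] c(1) unfolding n_def by auto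
  have less: "c k = 0" if "k < n" for k
    using not_less_Least[of k "\<lambda>k. k \<le> m \<and> c k \<noteq> 0"] that n(1) unfolding n_def by auto
  \<comment> \<open>At \<open>x1^(n+1)\<close> the terms with \<open>k < n\<close> vanish by
    minimality of \<open>n\<close>, those with \<open>k > n\<close> because the iterate has no terms
    of positive degree up to \<open>k\<close> on the axis.\<close>
  have "(\<Sum>k\<le>m. c k * (raise ^^ k) (F l) (Suc n) 0)
      = (\<Sum>k\<le>m. if k = n then c n * (raise ^^ n) (F l) (Suc n) 0 else 0)"
  proof (intro sum.cong refl)
    fix k
    show "c k * (raise ^^ k) (F l) (Suc n) 0 = (if k = n then c n * (raise ^^ n) (F l) (Suc n) 0 else 0)"
      using less[of k] raise_funpow_below[of "Suc n" k "F l"] by (cases k n rule: linorder_cases) auto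
  qed
  also have "\<dots> = c n * (fact n * F l 1 0)"
    using n(1) by (simp add: raise_funpow_diag)
  finally show False
    using comb[of "Suc n"] n(2) l(2) by (simp add: F_def ord_coeff_def)
qed

end
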